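(* Let $K$ be a finite Eulerian poset with minimum $\hat 0$ and rank function $\rho$, and let $P\in\mathrm{Or}(K)$ be a special partial projection, i.e. an idempotent of the monoid $M_p^K$ which is a projection. Then the induced subposets $\mathrm{Im}(P)$ and $(K\setminus\mathrm{Im}(P))\cup\{\hat 0\}$ of $K$ are graded with rank function (the restriction of) $\rho$.
   Context: A finite poset $K$ is graded if it has a minimum $\hat 0$, maximum $\hat 1$ and rank function $\rho$ ($\rho(y)=\rho(x)+1$ whenever $y$ covers $x$, written $x\vartriangleleft y$); it is Eulerian if moreover $\mu_K(x,y)=(-1)^{\rho(y)-\rho(x)}$ for all $x\leqslant y$. $\mathrm{Or}(K)$ is the monoid under composition of order preserving regressive ($f(x)\leqslant x$) maps $K\to K$. A partial matching of $K$ is a map $M_p:K\to K$ with $M_p\circ M_p=\mathrm{id}_K$, $M_p(\hat 1)\vartriangleleft\hat 1$, and for every $x$ either $M_p(x)\vartriangleleft x$, $x\vartriangleleft M_p(x)$ or $M_p(x)=x$; it is a special partial matching if $x\vartriangleleft y$ and $x\ne M_p(y)$ imply $M_p(x)\leqslant M_p(y)$. For such $M_p$, $P^{M_p}(x)=x$ if $x\leqslant M_p(x)$ and $P^{M_p}(x)=M_p(x)$ if $M_p(x)\vartriangleleft x$. $M_p^K$ is the submonoid of $\mathrm{Or}(K)$ generated by $\mathrm{id}_K$ and all $P^{M_p}$, $M_p$ a special partial matching of $K$. For $f:K\to K$, $f_y:=\{x:f(x)=y\}$. An idempotent $P\in\mathrm{Or}(K)$ is a projection if for all $x,y\in\mathrm{Im}(P)$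 with $x\leqslant y$ the set $[x,y]\cap P_x$ is an interval of $K$. *)

theory Defs
  imports Main
begin

text \<open>
  A finite poset with minimum and maximum is a type of sort finite, order_bot, order_top; its
  minimum and maximum are \<^const>\<open>bot\<close> and \<^const>\<open>top\<close>. Induced subposets are subsets of the type.
  In particular, a covering in a subposet \<open>A\<close> is taken relative to \<open>A\<close>: it need not be a
  covering in the ambient poset.
\<close>

definition covers_on :: "'a::order set \<Rightarrow> 'a \<Rightarrow> 'a \<Rightarrow> bool" where
  "covers_on A x y \<longleftrightarrow> x \<in> A \<and> y \<in> A \<and> x < y \<and> \<not> (\<exists>z\<in>A. x < z \<and> z < y)"

abbreviation covered_by :: "'a::order \<Rightarrow> 'a \<Rightarrow> bool" (infix "\<lhd>" 50) where
  "x \<lhd> y \<equiv> covers_on UNIV x y"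

definition graded_on :: "'a::order set \<Rightarrow> ('a \<Rightarrow> nat) \<Rightarrow> bool" where
  "graded_on A \<rho> \<longleftrightarrow> finite A
     \<and> (\<exists>m\<in>A. \<forall>x\<in>A. m \<le> x)
     \<and> (\<exists>m\<in>A. \<forall>x\<in>A. x \<le> m)
     \<and> (\<forall>x y. covers_on A x y \<longrightarrow> \<rho> y = \<rho> x + 1)"

text \<open>The Moebius function of a finite poset; as usual it is \<open>0\<close> on pairs with \<open>\<not> x \<le> y\<close>.\<close>

function mobius :: "'a::{finite,order} \<Rightarrow> 'a \<Rightarrow> int" where
  "mobius x y = (if x = y then 1 else if x < y then - (\<Sum>z\<in>{x..<y}. mobius x z) else 0)"
  by auto
termination
proof (relation "measure (\<lambda>(x, y). card {z. z < y})")
  fix x y z :: 'a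
  assume "z \<in> {x..<y}"
  then have "{w. w < z} \<subset> {w. w < y}"
    by auto
  then show "((x, z), (x, y)) \<in> measure (\<lambda>(x, y). card {z. z < y})"
    by (simp add: psubset_card_mono)
qed simp

declare mobius.simps [simp del]

definition eulerian :: "('a::{finite,order_bot,order_top} \<Rightarrow> nat) \<Rightarrow> bool" where
  "eulerian \<rho> \<longleftrightarrow> graded_on (UNIV :: 'a set) \<rho>
     \<and> (\<forall>x y. x \<le> y \<longrightarrow> mobius x y = (- 1) ^ (\<rho> y - \<rho> x))"

definition Or :: "('a::order \<Rightarrow> 'a) set" where
  "Or = {f. mono f \<and> (\<forall>x. f x \<le> x)}"

definition partial_matching :: "('a::{finite,order_bot,order_top} \<Rightarrow> 'a) \<Rightarrow> bool" where
  "partial_matching M \<longleftrightarrow> M \<circ> M = id \<and> M top \<lhd> top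
     \<and> (\<forall>x. M x \<lhd> x \<or> x \<lhd> M x \<or> M x = x)"

definition special_partial_matching :: "('a::{finite,order_bot,order_top} \<Rightarrow> 'a) \<Rightarrow> bool" where
  "special_partial_matching M \<longleftrightarrow> partial_matching M
     \<and> (\<forall>x y. x \<lhd> y \<and> x \<noteq> M y \<longrightarrow> M x \<le> M y)"

text \<open>For a partial matching \<open>M\<close>, the second case below is exactly the case \<open>M x \<lhd> x\<close>.\<close>

definition matching_map :: "('a::order \<Rightarrow> 'a) \<Rightarrow> 'a \<Rightarrow> 'a" where
  "matching_map M x = (if x \<le> M x then x else M x)"

inductive_set matching_monoid :: "('a::{finite,order_bot,order_top} \<Rightarrow> 'a) set" where
  id: "id \<in> matching_monoid"
| generator: "special_partial_matching M \<Longrightarrow> matching_map M \<in> matching_monoid"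
| comp: "f \<in> matching_monoid \<Longrightarrow> g \<in> matching_monoid \<Longrightarrow> f \<circ> g \<in> matching_monoid"

definition projection :: "('a::order \<Rightarrow> 'a) \<Rightarrow> bool" where
  "projection P \<longleftrightarrow> P \<in> Or \<and> P \<circ> P = P
     \<and> (\<forall>x\<in>range P. \<forall>y\<in>range P. x \<le> y \<longrightarrow>
          (\<exists>a b. a \<le> b \<and> {x..y} \<inter> {z. P z = x} = {a..b}))"

definition special_partial_projection :: "('a::{finite,order_bot,order_top} \<Rightarrow> 'a) \<Rightarrow> bool" where
  "special_partial_projection P \<longleftrightarrow> P \<in> matching_monoid \<and> P \<circ> P = P \<and> projection P"

end

theory Submission
  imports Defs
begin

text \<open>
  An interval of length at least two in an Eulerian poset cannot have a greatest element below its
  top, because its Moebius value would then vanish. A covering in either subposet that is not a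
  covering in the ambient poset produces such an interval: for the image the extra element is the
  top of the fibre over the lower end, for the complement it is the image of the upper end.
\<close>

lemma mobius_sum_eq_0:
  fixes x b :: "'a::{finite,order}"
  assumes "x < b"
  shows "(\<Sum>z\<in>{x..b}. mobius x z) = 0"
proof -
  have "{x..b} = insert b {x..<b}"
    using assms by auto
  moreover have "mobius x b = - (\<Sum>z\<in>{x..<b}. mobius x z)"
    using assms by (subst mobius.simps) simp
  ultimately show ?thesis
    by simp
qed

text \<open>If \<open>x < b\<close> held, the recursion for \<open>mobius x y\<close> would sum over
  the closed interval from \<open>x\<close> to \<open>b\<close>, where the total is 0, while the
  Eulerian value is 1 or -1. Hence \<open>b = x\<close>, and nothing lies strictly between
  \<open>x\<close> and \<open>y\<close>.\<close>

lemma eulerian_covered_by: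
  fixes \<rho> :: "'a::{finite,order_bot,order_top} \<Rightarrow> nat" and x y b :: 'a
  assumes "eulerian \<rho>" and "x < y" and eq: "{x..<y} = {x..b}"
  shows "x \<lhd> y"
proof -
  have "x \<le> b"
    using assms(2) eq by (metis atLeastAtMost_iff atLeastLessThan_iff order_refl)
  moreover have "\<not> x < b"
  proof
    assume "x < b"
    have "mobius x y = - (\<Sum>z\<in>{x..b}. mobius x z)"
      using assms(2) eq by (subst mobius.simps) simp
    also have "\<dots> = 0"
      using mobius_sum_eq_0[OF \<open>x < b\<close>] by simp
    finally show False
      using assms(1,2) by (auto simp: eulerian_def)
  qed
  ultimately have "{x..<y} = {x}"
    using eq by simp
  then show ?thesis
    using assms(2) unfolding covers_on_def
    by (metis UNIV_I atLeastLessThan_iff less_imp_le less_irrefl singletonD)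
qed

lemma eulerian_rank_covered_by:
  assumes "eulerian \<rho>" and "x \<lhd> y"
  shows "\<rho> y = \<rho> x + 1"
  using assms by (auto simp: eulerian_def graded_on_def)

lemma matching_monoid_regressive:
  assumes "f \<in> matching_monoid"
  shows "f x \<le> x"
  using assms
proof (induction arbitrary: x rule: matching_monoid.induct)
  case (generator M)
  then have "M x \<lhd> x \<or> x \<lhd> M x \<or> M x = x"
    by (simp add: special_partial_matching_def partial_matching_def)
  then show ?case
    by (auto simp: matching_map_def covers_on_def)
qed (auto intro: order_trans)

text \<open>Every generator moves \<open>top\<close>, since a partial matching sends it to a coatom.
  In a composition, regressivity of the outer factor forces the inner one to fix \<open>top\<close>,
  so both factors are the identity. This is what supplies the complement with a maximum.\<close>

lemma matching_monoid_top:
  fixes f :: "'a::{finite,order_bot,order_top} \<Rightarrow> 'a"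
  assumes "f \<in> matching_monoid" and "f top = top"
  shows "f = id"
  using assms
proof (induction rule: matching_monoid.induct)
  case (generator M)
  then have "M top < top"
    by (simp add: special_partial_matching_def partial_matching_def covers_on_def)
  then show ?case
    using generator.prems by (simp add: matching_map_def less_le_not_le split: if_splits)
next
  case (comp f g)
  have "g top = top"
    using comp.prems matching_monoid_regressive[OF comp.hyps(1), of "g top"]
    by (simp add: top_unique)
  then show ?case
    using comp by simp
qed simp

lemma graded_on_range_projection:
  fixes \<rho> :: "'a::{finite,order_bot,order_top} \<Rightarrow> nat"
  assumes "eulerian \<rho>" and "projection P"
  shows "graded_on (range P) \<rho>"
proof -
  have mono: "mono P" and regr: "\<And>x. P x \<le> x"
    and idem: "\<And>x. P (P x) = P x"
    using assms(2) by (auto simp: projection_def Or_def fun_eq_iff)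
  have "\<rho> y = \<rho> x + 1" if cov: "covers_on (range P) x y" for x y
  proof -
    have mem: "x \<in> range P" "y \<in> range P" and "x < y"
      and gap: "\<And>z. x < P z \<Longrightarrow> \<not> P z < y"
      using cov by (auto simp: covers_on_def)
    have Px: "P x = x" and Py: "P y = y"
      using mem idem by auto
    obtain a b where ab: "{x..y} \<inter> {z. P z = x} = {a..b}"
      using assms(2) mem \<open>x < y\<close> unfolding projection_def by (meson less_imp_le)
    \<comment> \<open>Here x = P x \<le> P z \<le> z < y, and \<open>P z\<close> lies in the image,
      so the gap leaves only \<open>x\<close>.\<close>
    have "P z = x" if "x \<le> z" "z < y" for z
      using monoD[OF mono \<open>x \<le> z\<close>] gap[of z] regr[of z] that(2) Px
      by (metis le_less_trans order_le_less)
    \<comment> \<open>The fibre over \<open>x\<close> omits only \<open>y\<close>, which is fixed by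
      \<open>P\<close>; its top \<open>b\<close> is then the greatest element below
      \<open>y\<close>.\<close>
    then have eq: "{x..<y} = {a..b}"
      using ab Py \<open>x < y\<close> by (force simp: order_less_le)
    have "x \<in> {a..b}"
      using eq \<open>x < y\<close> by auto
    then have "a \<in> {x..<y}"
      using eq by auto
    with \<open>x \<in> {a..b}\<close> have "a = x"
      by auto
    then show ?thesis
      using eulerian_covered_by assms(1) \<open>x < y\<close> eq eulerian_rank_covered_by by metis
  qed
  moreover have "P bot \<le> P x" "P x \<le> P top" for x
    by (auto intro: monoD[OF mono])
  ultimately show ?thesis
    unfolding graded_on_def by auto
qed

text \<open>The hypothesis \<open>top\<close> yields the maximum: either \<open>top\<close> itself
  lies in the complement, or \<open>P = id\<close> and the set shrinks to
  \<open>{bot}\<close>.\<close>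

lemma graded_on_compl_range:
  fixes \<rho> :: "'a::{finite,order_bot,order_top} \<Rightarrow> nat"
  assumes "eulerian \<rho>" and "P \<in> Or" and "P \<circ> P = P" and top: "top \<notin> range P \<or> P = id"
  shows "graded_on ((UNIV - range P) \<union> {bot}) \<rho>"
proof -
  have mono: "mono P" and regr: "\<And>x. P x \<le> x"
    using assms(2) by (auto simp: Or_def)
  have fixed: "z \<in> range P \<Longrightarrow> P z = z" for z
    using assms(3) by (auto simp: fun_eq_iff)
  have "\<rho> y = \<rho> x + 1" if cov: "covers_on ((UNIV - range P) \<union> {bot}) x y" for x y
  proof -
    have "x < y" and gap: "\<And>z. x < z \<Longrightarrow> z < y \<Longrightarrow> z \<in> range P"
      using cov by (auto simp: covers_on_def)
    \<comment> \<open>The added point \<open>bot\<close> cannot be the upper end, as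
      \<open>x < y\<close>.\<close>
    then have "y \<notin> range P"
      using cov by (auto simp: covers_on_def)
    then have "P y < y"
      using regr[of y] by (metis order_le_less rangeI)
    \<comment> \<open>Elements inside the gap lie in the image, hence are fixed: z = P z \<le> P
      y.\<close>
    have below: "z \<le> P y" if "x < z" "z < y" for z
      using fixed[OF gap[OF that]] monoD[OF mono, of z y] that(2) by simp
    have "x \<lhd> y"
    proof (rule ccontr)
      assume "\<not> x \<lhd> y"
      then obtain w where "x < w" "w < y"
        using \<open>x < y\<close> by (auto simp: covers_on_def)
      \<comment> \<open>The witness \<open>w\<close> puts \<open>P y\<close> strictly above
        \<open>x\<close>, so \<open>P y\<close> is the greatest element of the half-open
        interval.\<close>
      then have "x < P y"
        using below by (metis less_le_trans)
      then have "{x..<y} = {x..P y}"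
        using below \<open>P y < y\<close> by (fastforce simp: order_le_less)
      then show False
        using eulerian_covered_by[OF assms(1) \<open>x < y\<close>] \<open>\<not> x \<lhd> y\<close> by blast
    qed
    then show ?thesis
      by (rule eulerian_rank_covered_by[OF assms(1)])
  qed
  moreover have "\<exists>m\<in>(UNIV - range P) \<union> {bot}. \<forall>x\<in>(UNIV - range P) \<union> {bot}. x \<le> m"
    using top by (metis Diff_iff UNIV_I UnCI Un_empty_left Diff_cancel
        bot_least singletonD singletonI surj_id top_greatest)
  ultimately show ?thesis
    unfolding graded_on_def by auto
qed

theorem theorem5p8:
  fixes \<rho> :: "'a::{finite,order_bot,order_top} \<Rightarrow> nat"
    and P :: "'a \<Rightarrow> 'a"
  assumes "eulerian \<rho>"
    and "special_partial_projection P"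
  shows "graded_on (range P) \<rho> \<and> graded_on ((UNIV - range P) \<union> {bot}) \<rho>"
proof
  have P: "P \<in> matching_monoid" "P \<circ> P = P" "projection P"
    using assms(2) by (auto simp: special_partial_projection_def)
  show "graded_on (range P) \<rho>"
    using assms(1) P(3) by (rule graded_on_range_projection)
  \<comment> \<open>By idempotence, an image containing \<open>top\<close> means that
    \<open>P\<close> fixes \<open>top\<close>.\<close>
  have "P = id" if "top \<in> range P"
  proof -
    have "P top = top"
      using that P(2) by (metis comp_apply imageE)
    then show ?thesis
      by (rule matching_monoid_top[OF P(1)])
  qed
  then show "graded_on ((UNIV - range P) \<union> {bot}) \<rho>"
    using assms(1) P graded_on_compl_range[of \<rho> P] by (auto simp: projection_def)
qed

end
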